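(* Let $S=S(b_1,\dots,b_k)$ be an extended star and let $m$ be a positive integer such that $S$ has an $m$-packed labeling. Then the order of $\partial_K$ acting on $\mathcal{L}_m(S)$ is $$o(\partial_K)=\begin{cases}1 & \text{if } b_i=m-1 \text{ for all } i,\\ m-1 & \text{otherwise.}\end{cases}$$
   Context: An extended star $S(b_1,\dots,b_k)$ is a poset consisting of a minimum element $\hat 0$ together with $k$ pairwise incomparable chains (branches) $B_1,\dots,B_k$ lying above $\hat0$, where $B_i$ has $b_i\ge 1$ elements; i.e. $S-\{\hat0\}$ is the disjoint union of these chains. For a positive integer $m$, an $m$-packed labeling of a finite poset $P$ is a surjection $L:P\to\{1,\dots,m\}$ such that $x<_P y$ implies $L(x)<L(y)$; $\mathcal{L}_m(P)$ is the set of them. $K$-promotion $\partial_K:\mathcal{L}_m(P)\to\mathcal{L}_m(P)$: given $L$, erase the labels of all elements labeled $1$; then for $i=2,\dots,m$ in turn, for every cover relation $x\lessdot y$ with $x$ currently unlabeled and $y$ currently labeled $i$, give $x$ label $i$ and erase the label of $y$ (simultaneously for all such pairs); finally decrease every existing label by $1$ and label every unlabeled element $m$. This is a bijection; $o(\partial_K)$ denotes its order as a permutation. *)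

theory Defs
  imports "HOL-Algebra.Algebra"
begin

text \<open>
  A finite poset is given by its ground set \<open>P\<close> and its reflexive order relation \<open>r\<close>
  with \<open>partial_order_on P r\<close>.
\<close>

definition covered_by :: "'a rel \<Rightarrow> 'a \<Rightarrow> 'a \<Rightarrow> bool" where
  "covered_by r x y \<longleftrightarrow>
     (x, y) \<in> r \<and> x \<noteq> y \<and> \<not> (\<exists>z. (x, z) \<in> r \<and> (z, y) \<in> r \<and> z \<noteq> x \<and> z \<noteq> y)"

text \<open>
  \<open>extended_star P r bs\<close>: the poset \<open>(P, r)\<close> is the extended star
  \<open>S(b\<^sub>1, \<dots>, b\<^sub>k)\<close> with \<open>bs = [b\<^sub>1, \<dots>, b\<^sub>k]\<close>.  The branches are
  indexed from 0.  They are automatically disjoint, since \<open>r\<close> is reflexive on \<open>P\<close>.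
\<close>

definition extended_star :: "'a set \<Rightarrow> 'a rel \<Rightarrow> nat list \<Rightarrow> bool" where
  "extended_star P r bs \<longleftrightarrow>
     partial_order_on P r \<and>
     (\<exists>z B. (\<forall>x\<in>P. (z, x) \<in> r) \<and>
       P = insert z (\<Union>i<length bs. B i) \<and>
       (\<forall>i<length bs. z \<notin> B i \<and> finite (B i) \<and> card (B i) = bs ! i \<and> 1 \<le> bs ! i \<and>
          total_on (B i) r) \<and>
       (\<forall>i<length bs. \<forall>j<length bs. i \<noteq> j \<longrightarrow>
          (\<forall>x\<in>B i. \<forall>y\<in>B j. (x, y) \<notin> r \<and> (y, x) \<notin> r)))"

text \<open>
  Labelings are extensional functions on \<open>P\<close> (equal to \<open>undefined\<close> outside \<open>P\<close>), so that
  different elements of \<open>packed_labelings P r m\<close> differ on \<open>P\<close>.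
\<close>

definition packed_labelings :: "'a set \<Rightarrow> 'a rel \<Rightarrow> nat \<Rightarrow> ('a \<Rightarrow> nat) set" where
  "packed_labelings P r m =
     {L \<in> P \<rightarrow>\<^sub>E {1..m}. L ` P = {1..m} \<and>
        (\<forall>x\<in>P. \<forall>y\<in>P. (x, y) \<in> r \<and> x \<noteq> y \<longrightarrow> L x < L y)}"

text \<open>
  During K-promotion a labeling is partial; \<open>None\<close> means unlabeled.  A single step refers only
  to the labels \<open>L\<close> before the step, so all cover relations are treated simultaneously.
\<close>

definition K_step :: "'a rel \<Rightarrow> nat \<Rightarrow> ('a \<Rightarrow> nat option) \<Rightarrow> 'a \<Rightarrow> nat option" where
  "K_step r i L = (\<lambda>z.
     if L z = None \<and> (\<exists>y. covered_by r z y \<and> L y = Some i) then Some i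
     else if L z = Some i \<and> (\<exists>x. covered_by r x z \<and> L x = None) then None
     else L z)"

definition K_erase :: "'a set \<Rightarrow> ('a \<Rightarrow> nat) \<Rightarrow> 'a \<Rightarrow> nat option" where
  "K_erase P L = (\<lambda>x. if x \<in> P \<and> L x \<noteq> 1 then Some (L x) else None)"

definition K_promotion :: "'a set \<Rightarrow> 'a rel \<Rightarrow> nat \<Rightarrow> ('a \<Rightarrow> nat) \<Rightarrow> 'a \<Rightarrow> nat" where
  "K_promotion P r m L =
     (\<lambda>x\<in>P. case fold (K_step r) [2..<Suc m] (K_erase P L) x of
        None \<Rightarrow> m | Some j \<Rightarrow> j - 1)"

text \<open>
  K-promotion as an element of the symmetric group \<open>BijGroup\<close> on the set of labelings, whose
  elements are extensional as well.
\<close>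

definition K_promotion_perm ::
  "'a set \<Rightarrow> 'a rel \<Rightarrow> nat \<Rightarrow> ('a \<Rightarrow> nat) \<Rightarrow> 'a \<Rightarrow> nat" where
  "K_promotion_perm P r m = restrict (K_promotion P r m) (packed_labelings P r m)"

end

theory Submission
  imports Defs "HOL-Library.Infinite_Set" "HOL-Combinatorics.Transposition"
    "HOL-Number_Theory.Cong"
begin

text \<open>
  A packed labeling is determined by the label sets of the branches, which are subsets of
  \<open>{2..m}\<close> with union \<open>{2..m}\<close>. Only the branches containing the label \<open>2\<close> move under
  promotion: their labels slide down by one position and the top element gets \<open>m\<close>. In terms of
  label sets, promotion therefore is the cyclic shift \<open>2 \<mapsto> m\<close>, \<open>a \<mapsto> a - 1\<close> of \<open>{2..m}\<close>,
  which has order \<open>m - 1\<close>. If some branch has fewer than \<open>m - 1\<close> elements, then no smaller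
  power of the shift fixes all labelings.
\<close>

section \<open>The cyclic shift of \<open>{2..m}\<close>\<close>

definition cyc :: "nat \<Rightarrow> nat \<Rightarrow> nat" where
  "cyc m a = (if a = 2 then m else a - 1)"

lemma cyc_mem: "a \<in> {2..m} \<Longrightarrow> cyc m a \<in> {2..m}"
  by (auto simp: cyc_def)

lemma inj_on_cyc: "inj_on (cyc m) {2..m}"
  by (auto simp: inj_on_def cyc_def split: if_splits)

lemma cyc_image: "cyc m ` {2..m} = {2..m}"
  by (intro endo_inj_surj inj_on_cyc) (auto simp del: atLeastAtMost_iff intro: cyc_mem)

lemma funpow_cyc_mem: "a \<in> {2..m} \<Longrightarrow> (cyc m ^^ n) a \<in> {2..m}"
  by (induction n) (auto simp del: atLeastAtMost_iff intro: cyc_mem)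

text \<open>Modulo \<open>m - 1\<close> the wrap from \<open>2\<close> to \<open>m\<close> is also a
  decrease by one. Adding \<open>n\<close> on the left avoids truncated subtraction.\<close>

lemma funpow_cyc:
  assumes "a \<in> {2..m}"
  shows "[(cyc m ^^ n) a + n = a] (mod (m - 1))"
proof (induction n)
  case (Suc n)
  let ?c = "(cyc m ^^ n) a"
  have "?c \<in> {2..m}"
    using assms by (rule funpow_cyc_mem)
  then have "cyc m ?c + 1 = ?c \<or> cyc m ?c + 1 = ?c + (m - 1)"
    by (auto simp: cyc_def)
  then have "[cyc m ?c + 1 = ?c] (mod (m - 1))"
    by (auto simp: cong_def)
  then have "[cyc m ?c + 1 + n = ?c + n] (mod (m - 1))"
    by (rule cong_add) simp
  then show ?case
    using Suc.IH cong_trans by (fastforce simp: add_ac)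
qed simp

text \<open>The elements of \<open>{2..m}\<close> are pairwise incongruent modulo
  \<open>m - 1\<close>, so the congruence for iterates decides equality.\<close>

lemma funpow_cyc_eq_iff:
  assumes "a \<in> {2..m}"
  shows "(cyc m ^^ n) a = a \<longleftrightarrow> m - 1 dvd n"
proof
  assume "(cyc m ^^ n) a = a"
  with funpow_cyc[OF assms, of n] have "[a + n = a + 0] (mod (m - 1))"
    by simp
  then show "m - 1 dvd n"
    by (metis cong_add_lcancel_nat cong_0_iff)
next
  assume "m - 1 dvd n"
  then have "[(cyc m ^^ n) a + n = (cyc m ^^ n) a + 0] (mod (m - 1))"
    by (metis cong_add_lcancel_nat cong_0_iff)
  then have "[(cyc m ^^ n) a = a] (mod (m - 1))"
    using funpow_cyc[OF assms, of n] by (metis add.right_neutral cong_sym cong_trans)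
  moreover have "(cyc m ^^ n) a \<in> {2..m}"
    using assms by (rule funpow_cyc_mem)
  \<comment> \<open>Subtracting \<open>2\<close> moves both numbers below \<open>m - 1\<close>,
    where congruence is equality.\<close>
  ultimately have "[(cyc m ^^ n) a - 2 = a - 2] (mod (m - 1))"
    using assms cong_diff_nat[OF _ cong_refl] by auto
  moreover have "(cyc m ^^ n) a - 2 < m - 1" "a - 2 < m - 1"
    using \<open>(cyc m ^^ n) a \<in> {2..m}\<close> assms by auto
  ultimately have "(cyc m ^^ n) a - 2 = a - 2"
    by (simp add: cong_def)
  then show "(cyc m ^^ n) a = a"
    using \<open>(cyc m ^^ n) a \<in> {2..m}\<close> assms by auto
qed

section \<open>Promotion within one branch\<close>

text \<open>
  In the course of promotion up to the label \<open>i\<close>, an element with label \<open>a\<close> in a branch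
  with label set \<open>A\<close> carries \<open>slide A i a\<close>; a branch without the label \<open>2\<close> never moves.
\<close>

definition slide :: "nat set \<Rightarrow> nat \<Rightarrow> nat \<Rightarrow> nat option" where
  "slide A i a =
     (if 2 \<notin> A \<or> i < a then Some a
      else if \<exists>b\<in>A. a < b \<and> b \<le> i then Some (Min {b\<in>A. a < b})
      else None)"

text \<open>The cover relation of the chain \<open>A\<close>; membership of \<open>a\<close> and
  \<open>b\<close> in \<open>A\<close> is left to the places of use.\<close>

definition next_in :: "nat set \<Rightarrow> nat \<Rightarrow> nat \<Rightarrow> bool" where
  "next_in A a b \<longleftrightarrow> a < b \<and> \<not> (\<exists>c\<in>A. a < c \<and> c < b)"

lemma Min_next_in: "finite A \<Longrightarrow> b \<in> A \<Longrightarrow> next_in A a b \<Longrightarrow> Min {c\<in>A. a < c} = b"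
  unfolding next_in_def by (rule Min_eqI) (fastforce simp flip: not_less)+

lemma Min_above:
  assumes "finite A" "b \<in> A" "(a::nat) < b"
  shows "Min {c\<in>A. a < c} \<in> A" "a < Min {c\<in>A. a < c}" "Min {c\<in>A. a < c} \<le> b"
proof -
  have "Min {c\<in>A. a < c} \<in> {c\<in>A. a < c}"
    using assms by (intro Min_in) auto
  then show "Min {c\<in>A. a < c} \<in> A" "a < Min {c\<in>A. a < c}"
    by auto
  show "Min {c\<in>A. a < c} \<le> b"
    using assms by (intro Min_le) auto
qed

text \<open>This is \<open>K_step\<close> for the label \<open>Suc i\<close>, read on label sets.
  The minimum of the star enters only through \<open>i = 1\<close>, since it is unlabeled only
  before label \<open>2\<close> is processed. The cases for \<open>a\<close> are: not yet reached,
  being vacated, already refilled, still empty.\<close>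

lemma slide_Suc:
  assumes A: "finite A" "A \<subseteq> {2..}" "a \<in> A" and i: "1 \<le> i"
  shows "slide A (Suc i) a =
    (if slide A i a = None \<and> (\<exists>b\<in>A. next_in A a b \<and> slide A i b = Some (Suc i))
     then Some (Suc i)
     else if slide A i a = Some (Suc i) \<and>
       (i = 1 \<and> \<not> (\<exists>c\<in>A. c < a) \<or> (\<exists>b\<in>A. next_in A b a \<and> slide A i b = None)) then None
     else slide A i a)"
proof (cases "2 \<in> A")
  case False
  \<comment> \<open>The only possible change would be the removal of a label \<open>2\<close> at
    \<open>i = 1\<close>.\<close>
  then have "a \<noteq> Suc (Suc 0)"
    using A(3) by (metis numeral_2_eq_2)
  with False show ?thesis
    by (auto simp: slide_def)
next
  case True
  consider "a > Suc i" | "a = Suc i" | b where "a \<le> i" "b \<in> A" "a < b" "b \<le> i"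
    | "a \<le> i" "\<not> (\<exists>b\<in>A. a < b \<and> b \<le> i)"
    by (meson leI le_antisym not_less_eq_eq)
  then show ?thesis
  proof cases
    case 1
    then show ?thesis by (simp add: slide_def)
  next
    case 2
    have "i = 1 \<and> \<not> (\<exists>c\<in>A. c < a) \<or> (\<exists>b\<in>A. next_in A b a \<and> slide A i b = None)"
    proof (cases "i = 1")
      case True
      then have "\<not> c < a" if "c \<in> A" for c
        using subsetD[OF A(2) that] 2 by simp
      with True show ?thesis by blast
    next
      case False
      \<comment> \<open>The predecessor of \<open>a\<close> in \<open>A\<close> exists because
        \<open>2\<close> lies below \<open>a\<close>; it is empty at this stage because its next
        label is \<open>Suc i\<close> itself.\<close>
      have "finite {c\<in>A. c < a}" "2 \<in> {c\<in>A. c < a}"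
        using A(1) True False 2 i by simp_all
      then obtain b where b: "b \<in> A" "b < a" "\<And>c. c \<in> A \<Longrightarrow> c < a \<Longrightarrow> c \<le> b"
        using Max_in Max_ge by (metis (mono_tags, lifting) empty_iff mem_Collect_eq)
      then have "next_in A b a"
        using leD by (auto simp: next_in_def)
      moreover have "\<not> (\<exists>c\<in>A. b < c \<and> c \<le> i)"
        using b(3) 2 by (meson leD less_Suc_eq_le)
      then have "slide A i b = None"
        using b(2) 2 True by (simp add: slide_def)
      ultimately show ?thesis using b(1) by blast
    qed
    moreover have "slide A i a = Some (Suc i)" "slide A (Suc i) a = None"
      using 2 True by (auto simp: slide_def)
    ultimately show ?thesis by simp
  next
    case 3
    then have "\<exists>b\<in>A. a < b \<and> b \<le> i" "\<exists>b\<in>A. a < b \<and> b \<le> Suc i"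
      by (auto intro: le_SucI)
    then have "slide A i a = Some (Min {b\<in>A. a < b})" "slide A (Suc i) a = slide A i a"
      using 3 True by (auto simp: slide_def)
    \<comment> \<open>The refilled position holds a label at most \<open>i\<close>, so the removal
      of \<open>Suc i\<close> does not affect it.\<close>
    moreover have "Min {b\<in>A. a < b} \<noteq> Suc i"
      using Min_above(3)[OF A(1) 3(2,3)] 3(4) by linarith
    ultimately show ?thesis by simp
  next
    case 4
    have none: "slide A i a = None"
      using 4 True by (auto simp: slide_def)
    \<comment> \<open>The successor of \<open>a\<close> exceeds \<open>i\<close> and therefore still
      carries its original label.\<close>
    have *: "slide A i b = Some (Suc i) \<longleftrightarrow> b = Suc i" if b: "b \<in> A" "next_in A a b" for b
    proof -
      have "i < b" using 4 b by (auto simp: next_in_def not_le)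
      then show ?thesis by (simp add: slide_def)
    qed
    show ?thesis
    proof (cases "Suc i \<in> A")
      case True
      then have n: "next_in A a (Suc i)"
        using 4 by (auto simp: next_in_def less_Suc_eq_le)
      then have "\<exists>b\<in>A. a < b \<and> b \<le> Suc i"
        using True by (auto simp: next_in_def)
      then have "slide A (Suc i) a = Some (Suc i)"
        using 4 \<open>2 \<in> A\<close> Min_next_in[OF A(1) True n] by (simp add: slide_def)
      moreover have "\<exists>b\<in>A. next_in A a b \<and> slide A i b = Some (Suc i)"
        using True n * by blast
      ultimately show ?thesis
        using none by simp
    next
      case False
      then have "\<not> (\<exists>b\<in>A. a < b \<and> b \<le> Suc i)"
        using 4 by (auto simp: le_Suc_eq)
      then have "slide A (Suc i) a = None"
        using 4 True by (auto simp: slide_def)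
      moreover have "\<not> (\<exists>b\<in>A. next_in A a b \<and> slide A i b = Some (Suc i))"
        using False * by blast
      ultimately show ?thesis
        using none by simp
    qed
  qed
qed

definition promote_label :: "nat \<Rightarrow> nat set \<Rightarrow> nat \<Rightarrow> nat" where
  "promote_label m A a = (case slide A m a of None \<Rightarrow> m | Some j \<Rightarrow> j - 1)"

text \<open>If \<open>2\<close> is in \<open>A\<close>, each label becomes its successor in
  \<open>A\<close> minus one, hence less than \<open>m\<close>, and the top becomes
  \<open>m\<close>. Otherwise all labels drop by one.\<close>

lemma promote_label_less:
  assumes A: "A \<subseteq> {2..m}" and "a \<in> A" "b \<in> A" "a < b"
  shows "promote_label m A a < promote_label m A b"
proof (cases "2 \<in> A")
  case False
  moreover have "2 \<le> a"
    using assms by auto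
  ultimately show ?thesis
    using assms by (auto simp: promote_label_def slide_def)
next
  case True
  have fin: "finite A" using A finite_subset by blast
  have le: "c \<le> m \<and> 2 \<le> c" if "c \<in> A" for c using A that by auto
  have pa: "promote_label m A a = Min {c\<in>A. a < c} - 1"
    using True assms le by (auto simp: promote_label_def slide_def not_less dest: le split: if_splits)
  note ma = Min_above[OF fin \<open>b \<in> A\<close> \<open>a < b\<close>]
  show ?thesis
  proof (cases "\<exists>c\<in>A. b < c")
    case True
    then obtain c where c: "c \<in> A" "b < c" by blast
    then have "promote_label m A b = Min {c\<in>A. b < c} - 1"
      using \<open>2 \<in> A\<close> le[OF \<open>b \<in> A\<close>] le[OF c(1)]
      by (auto simp: promote_label_def slide_def not_less)
    with Min_above(2)[OF fin c] ma pa le[OF ma(1)] show ?thesis by linarith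
  next
    case False
    then have "promote_label m A b = m"
      using \<open>2 \<in> A\<close> le[OF \<open>b \<in> A\<close>] by (auto simp: promote_label_def slide_def)
    with ma pa le[OF \<open>b \<in> A\<close>] show ?thesis by linarith
  qed
qed

text \<open>The new label is the shift of \<open>a\<close> itself in an unmoved branch, of
  \<open>2\<close> at the top of a moved one, and of the successor of \<open>a\<close>
  elsewhere.\<close>

lemma promote_label_mem:
  assumes A: "A \<subseteq> {2..m}" and "a \<in> A"
  shows "promote_label m A a \<in> cyc m ` A"
proof -
  have fin: "finite A" using A finite_subset by blast
  have le: "c \<le> m \<and> 2 \<le> c" if "c \<in> A" for c using A that by auto
  consider "2 \<notin> A" | "2 \<in> A" "\<not> (\<exists>b\<in>A. a < b)" | b where "2 \<in> A" "b \<in> A" "a < b"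
    by blast
  then show ?thesis
  proof cases
    case 1
    then have "promote_label m A a = cyc m a"
      using assms by (auto simp: promote_label_def slide_def cyc_def)
    with assms show ?thesis by simp
  next
    case 2
    then have "promote_label m A a = cyc m 2"
      using le[OF \<open>a \<in> A\<close>] by (auto simp: promote_label_def slide_def cyc_def)
    with 2 show ?thesis by simp
  next
    case 3
    note mb = Min_above[OF fin 3(2,3)]
    have "promote_label m A a = Min {c\<in>A. a < c} - 1"
      using 3 le[OF \<open>a \<in> A\<close>] le[OF 3(2)]
      by (auto simp: promote_label_def slide_def)
    moreover have "Min {c\<in>A. a < c} \<noteq> 2"
      using mb(2) le[OF \<open>a \<in> A\<close>] by linarith
    ultimately have "promote_label m A a = cyc m (Min {c\<in>A. a < c})"
      by (simp add: cyc_def)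
    with mb(1) show ?thesis by simp
  qed
qed

text \<open>Both maps are injective on \<open>A\<close>, so the inclusion of the images is an
  equality by counting.\<close>

lemma promote_label_image:
  assumes A: "A \<subseteq> {2..m}"
  shows "promote_label m A ` A = cyc m ` A"
proof (rule card_subset_eq)
  show "finite (cyc m ` A)"
    using A finite_subset by blast
  show "promote_label m A ` A \<subseteq> cyc m ` A"
    using promote_label_mem[OF A] by blast
  have "inj_on (promote_label m A) A"
    by (rule linorder_inj_onI) (use promote_label_less[OF A] in \<open>fastforce+\<close>)
  moreover have "inj_on (cyc m) A"
    using inj_on_cyc A by (rule inj_on_subset)
  ultimately show "card (promote_label m A ` A) = card (cyc m ` A)"
    by (simp add: card_image)
qed

section \<open>Increasing maps between finite sets\<close>

lemma strict_mono_bij_betw_exists: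
  fixes A B :: "nat set"
  assumes "finite A" "finite B" "card A = card B"
  obtains h where "bij_betw h A B" "\<And>a b. a \<in> A \<Longrightarrow> b \<in> A \<Longrightarrow> a < b \<Longrightarrow> h a < h b"
proof -
  obtain f where f: "bij_betw f {..<card A} A" "strict_mono_on {..<card A} f"
    using ex_bij_betw_strict_mono_card[OF assms(1)] by blast
  obtain g where g: "bij_betw g {..<card B} B" "strict_mono_on {..<card B} g"
    using ex_bij_betw_strict_mono_card[OF assms(2)] by blast
  \<comment> \<open>The map \<open>g \<circ> ?i\<close> sends the element of a given rank in
    \<open>A\<close> to the element of the same rank in \<open>B\<close>.\<close>
  let ?i = "inv_into {..<card A} f"
  have i: "bij_betw ?i A {..<card A}"
    using f(1) by (rule bij_betw_inv_into)
  have "bij_betw (g \<circ> ?i) A B"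
    using bij_betw_trans[OF i] g(1) assms(3) by simp
  moreover have "(g \<circ> ?i) a < (g \<circ> ?i) b" if ab: "a \<in> A" "b \<in> A" "a < b" for a b
  proof -
    have mem: "?i a \<in> {..<card A}" "?i b \<in> {..<card A}"
      using i ab bij_betwE by blast+
    have fi: "f (?i a) = a" "f (?i b) = b"
      using ab f(1) by (auto simp: bij_betw_def f_inv_into_f)
    have "?i a < ?i b"
    proof (rule ccontr)
      assume "\<not> ?i a < ?i b"
      then have "f (?i b) \<le> f (?i a)"
        using strict_mono_on_leD[OF f(2) mem(2,1)] by simp
      with fi ab show False by simp
    qed
    then show ?thesis
      using strict_mono_onD[OF g(2), of "?i a" "?i b"] mem assms(3) by simp
  qed
  ultimately show ?thesis using that by blast
qed

text \<open>\<open>R\<close> is the strict order that \<open>f\<close> and \<open>g\<close> both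
  represent; a value is recovered from the common image by its rank.\<close>

lemma strict_mono_unique_image:
  fixes f g :: "'a \<Rightarrow> nat"
  assumes fin: "finite C"
    and f: "\<And>x y. x \<in> C \<Longrightarrow> y \<in> C \<Longrightarrow> f x < f y \<longleftrightarrow> R x y"
    and g: "\<And>x y. x \<in> C \<Longrightarrow> y \<in> C \<Longrightarrow> g x < g y \<longleftrightarrow> R x y"
    and inj: "inj_on f C" "inj_on g C"
    and eq: "f ` C = g ` C" and x: "x \<in> C"
  shows "f x = g x"
proof -
  \<comment> \<open>In both images, the value at \<open>x\<close> has the same rank.\<close>
  have rank: "card {b \<in> h ` C. b < h x} = card {y\<in>C. R y x}"
    if h: "\<And>x y. x \<in> C \<Longrightarrow> y \<in> C \<Longrightarrow> h x < h y \<longleftrightarrow> R x y" and "inj_on h C" for h :: "'a \<Rightarrow> nat"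
  proof -
    have "{b \<in> h ` C. b < h x} = h ` {y\<in>C. R y x}"
      using h x by auto
    moreover have "inj_on h {y\<in>C. R y x}"
      using \<open>inj_on h C\<close> by (rule inj_on_subset) auto
    ultimately show ?thesis by (simp add: card_image)
  qed
  \<comment> \<open>Ranks are strictly increasing on the image, so equal ranks force equal
    values.\<close>
  have mono: "card {b \<in> f ` C. b < u} < card {b \<in> f ` C. b < v}" if "u \<in> f ` C" "u < v" for u v
    using that fin by (intro psubset_card_mono) auto
  have "card {b \<in> f ` C. b < f x} = card {b \<in> f ` C. b < g x}"
    using rank[of f, OF f inj(1)] rank[of g, OF g inj(2)] eq by simp
  moreover have "f x \<in> f ` C" "g x \<in> f ` C"
    using x eq by auto
  ultimately show ?thesis
    using mono[of "f x" "g x"] mono[of "g x" "f x"] by (cases "f x" "g x" rule: linorder_cases) auto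
qed

section \<open>Extended stars and their packed labelings\<close>

locale star =
  fixes P :: "'a set" and r :: "'a rel" and z :: 'a and B :: "nat \<Rightarrow> 'a set" and k m :: nat
  assumes po: "partial_order_on P r"
    and z_least: "x \<in> P \<Longrightarrow> (z, x) \<in> r"
    and P_eq: "P = insert z (\<Union>i<k. B i)"
    and z_notin: "i < k \<Longrightarrow> z \<notin> B i"
    and finite_B: "i < k \<Longrightarrow> finite (B i)"
    and B_nonempty: "i < k \<Longrightarrow> B i \<noteq> {}"
    and total_B: "i < k \<Longrightarrow> total_on (B i) r"
    and incomparable: "i < k \<Longrightarrow> j < k \<Longrightarrow> i \<noteq> j \<Longrightarrow> x \<in> B i \<Longrightarrow> y \<in> B j \<Longrightarrow> (x, y) \<notin> r"
    and m_pos: "1 \<le> m"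
begin

abbreviation labs where "labs \<equiv> packed_labelings P r m"

abbreviation prom where "prom \<equiv> K_promotion P r m"

lemma r_subset: "(x, y) \<in> r \<Longrightarrow> x \<in> P \<and> y \<in> P"
  using partial_order_onD(4)[OF po] by blast

lemma r_antisym: "(x, y) \<in> r \<Longrightarrow> (y, x) \<in> r \<Longrightarrow> x = y"
  using partial_order_onD(3)[OF po] by (rule antisymD)

lemma B_subset: "i < k \<Longrightarrow> x \<in> B i \<Longrightarrow> x \<in> P"
  using P_eq by auto

lemma z_in: "z \<in> P"
  using P_eq by simp

lemma P_cases:
  assumes "x \<in> P"
  obtains "x = z" | i where "i < k" "x \<in> B i"
  using assms P_eq by auto

text \<open>A common element would be comparable to itself across two branches.\<close>

lemma B_disjoint: "i < k \<Longrightarrow> j < k \<Longrightarrow> x \<in> B i \<Longrightarrow> x \<in> B j \<Longrightarrow> i = j"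
  using incomparable B_subset partial_order_onD(1)[OF po] by (metis refl_onD)

text \<open>The minimum lies above nothing but itself, and elements of different branches are
  incomparable.\<close>

lemma above_in_branch:
  assumes "i < k" "x \<in> B i" "(x, y) \<in> r"
  shows "y \<in> B i"
proof -
  have "y \<in> P" using r_subset assms by blast
  then show ?thesis
  proof (cases rule: P_cases)
    case 1
    then have "x = z"
      using r_antisym z_least[OF B_subset[OF assms(1,2)]] assms(3) by blast
    then show ?thesis
      using z_notin assms by blast
  next
    case (2 j)
    then show ?thesis
      using incomparable[of i j x y] assms by blast
  qed
qed

text \<open>The label \<open>1\<close> occurs and can only sit at the minimum, so the branches share
  out \<open>{2..m}\<close>. Conversely, every strict relation starts at the minimum or stays inside
  a branch.\<close>

lemma labelings_iff:
  "L \<in> labs \<longleftrightarrow> L \<in> extensional P \<and> L z = 1 \<and>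
     (\<forall>i<k. \<forall>x\<in>B i. \<forall>y\<in>B i. (x, y) \<in> r \<and> x \<noteq> y \<longrightarrow> L x < L y) \<and>
     (\<Union>i<k. L ` B i) = {2..m}" (is "_ \<longleftrightarrow> ?R")
proof
  assume L: "L \<in> labs"
  then have mem: "L x \<in> {1..m}" if "x \<in> P" for x
    using that by (auto simp: packed_labelings_def)
  have less: "L x < L y" if "(x, y) \<in> r" "x \<noteq> y" for x y
    using L that r_subset by (auto simp: packed_labelings_def)
  have img: "L ` P = {1..m}"
    using L by (simp add: packed_labelings_def)
  have "1 \<in> L ` P"
    using m_pos img by simp
  then obtain x where "x \<in> P" "L x = 1"
    by auto
  then have z1: "L z = 1"
    using less[of z x] z_least mem[OF z_in] by (cases "x = z") fastforce+
  have B2: "2 \<le> L x" if "i < k" "x \<in> B i" for x i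
    using less[of z x] z_least B_subset[OF that] z_notin that z1 by fastforce
  have "(\<Union>i<k. L ` B i) = {2..m}"
  proof
    show "(\<Union>i<k. L ` B i) \<subseteq> {2..m}"
      using B2 mem B_subset by fastforce
    show "{2..m} \<subseteq> (\<Union>i<k. L ` B i)"
    proof
      fix a assume a: "a \<in> {2..m}"
      then have "a \<in> L ` P"
        using img by auto
      then obtain x where "x \<in> P" "L x = a" by blast
      then show "a \<in> (\<Union>i<k. L ` B i)"
        using a z1 by (cases x rule: P_cases) auto
    qed
  qed
  then show ?R
    using L z1 less by (auto simp: packed_labelings_def PiE_def)
next
  assume R: ?R
  have "L ` P = insert (L z) (\<Union>i<k. L ` B i)"
    unfolding P_eq by auto
  also have "\<dots> = insert 1 {2..m}"
    using R by simp
  also have "\<dots> = {1..m}"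
    using m_pos by auto
  finally have img: "L ` P = {1..m}" .
  have B2: "2 \<le> L x" if "i < k" "x \<in> B i" for i x
    using R that by fastforce
  have "L x < L y" if xy: "(x, y) \<in> r" "x \<noteq> y" for x y
  proof -
    have "x \<in> P" "y \<in> P"
      using r_subset xy by auto
    then show ?thesis
    proof (cases x rule: P_cases)
      case 1
      from \<open>y \<in> P\<close> show ?thesis
      proof (cases y rule: P_cases)
        case (2 i)
        with B2[of i y] R 1 show ?thesis by simp
      qed (use 1 xy in simp)
    next
      case (2 i)
      with above_in_branch[of i x y] R xy show ?thesis by blast
    qed
  qed
  then show "L \<in> labs"
    using img R by (auto simp: packed_labelings_def PiE_def)
qed

context
  fixes L assumes L: "L \<in> labs"
begin

lemma label_z: "L z = 1"
  using L labelings_iff by blast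

lemma label_branch: "i < k \<Longrightarrow> L ` B i \<subseteq> {2..m}"
  using L labelings_iff by blast

lemma label_less_iff:
  assumes "i < k" "x \<in> B i" "y \<in> B i"
  shows "L x < L y \<longleftrightarrow> (x, y) \<in> r \<and> x \<noteq> y"
proof -
  have less: "L u < L v" if "(u, v) \<in> r" "u \<noteq> v" "u \<in> B i" "v \<in> B i" for u v
    using L labelings_iff that assms(1) by blast
  show ?thesis
    using less[of x y] less[of y x] total_B[OF assms(1)] assms(2,3)
    unfolding total_on_def by (metis less_asym' less_irrefl)
qed

lemma label_inj_on: "i < k \<Longrightarrow> inj_on L (B i)"
  using label_less_iff total_B unfolding total_on_def by (metis inj_onI less_irrefl)

section \<open>Cover relations and promotion of a labeling\<close>

lemma covered_by_branch_iff:
  assumes "i < k" "x \<in> B i" "y \<in> B i"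
  shows "covered_by r x y \<longleftrightarrow> next_in (L ` B i) (L x) (L y)"
proof -
  have "(\<exists>w. (x, w) \<in> r \<and> (w, y) \<in> r \<and> w \<noteq> x \<and> w \<noteq> y) \<longleftrightarrow>
      (\<exists>w\<in>B i. L x < L w \<and> L w < L y)"
    using above_in_branch label_less_iff assms by metis
  then show ?thesis
    using label_less_iff[OF assms] by (auto simp: covered_by_def next_in_def)
qed

text \<open>Anything strictly between the minimum and \<open>x\<close> lies in the branch of
  \<open>x\<close>, since branches are upward closed.\<close>

lemma covered_by_least_iff:
  assumes "i < k" "x \<in> B i"
  shows "covered_by r z x \<longleftrightarrow> \<not> (\<exists>c\<in>L ` B i. c < L x)"
proof -
  have "(\<exists>w. (z, w) \<in> r \<and> (w, x) \<in> r \<and> w \<noteq> z \<and> w \<noteq> x) \<longleftrightarrow> (\<exists>w\<in>B i. L w < L x)"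
  proof
    assume "\<exists>w. (z, w) \<in> r \<and> (w, x) \<in> r \<and> w \<noteq> z \<and> w \<noteq> x"
    then obtain w where w: "(w, x) \<in> r" "w \<noteq> z" "w \<noteq> x" by blast
    then have "w \<in> P" using r_subset by blast
    then obtain j where j: "j < k" "w \<in> B j"
      using w by (cases rule: P_cases) auto
    then have "j = i"
      using above_in_branch[OF j w(1)] B_disjoint assms by blast
    then show "\<exists>w\<in>B i. L w < L x"
      using j w label_less_iff assms by blast
  next
    assume "\<exists>w\<in>B i. L w < L x"
    then show "\<exists>w. (z, w) \<in> r \<and> (w, x) \<in> r \<and> w \<noteq> z \<and> w \<noteq> x"
      using label_less_iff z_least z_notin B_subset assms by metis
  qed
  then show ?thesis
    using z_least B_subset z_notin assms by (auto simp: covered_by_def)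
qed

lemma covers_of_branch:
  assumes "i < k" "x \<in> B i"
  shows "(\<exists>y. covered_by r x y \<and> Q y) \<longleftrightarrow> (\<exists>y\<in>B i. next_in (L ` B i) (L x) (L y) \<and> Q y)"
  using covered_by_branch_iff[OF assms] above_in_branch[OF assms]
  by (metis covered_by_def)

text \<open>With \<open>covers_of_branch\<close>, this translates both existential conditions of
  \<open>K_step\<close>; \<open>Q\<close> stands for the test on the current label.\<close>

lemma covered_of_branch:
  assumes "i < k" "x \<in> B i"
  shows "(\<exists>w. covered_by r w x \<and> Q w) \<longleftrightarrow>
    \<not> (\<exists>c\<in>L ` B i. c < L x) \<and> Q z \<or> (\<exists>w\<in>B i. next_in (L ` B i) (L w) (L x) \<and> Q w)"
    (is "?l \<longleftrightarrow> ?r")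
proof
  assume ?l
  then obtain w where w: "covered_by r w x" "Q w" by blast
  then have "w \<in> P" "(w, x) \<in> r"
    using r_subset by (auto simp: covered_by_def)
  then show ?r
  proof (cases w rule: P_cases)
    case 1
    with w show ?thesis using covered_by_least_iff[OF assms] by blast
  next
    case (2 j)
    then have "j = i"
      using above_in_branch[OF 2 \<open>(w, x) \<in> r\<close>] B_disjoint assms by blast
    with w 2 show ?thesis using covered_by_branch_iff[OF assms(1) _ assms(2)] by blast
  qed
next
  assume ?r
  then show ?l
    using covered_by_least_iff[OF assms] covered_by_branch_iff[OF assms(1) _ assms(2)] by blast
qed

text \<open>Induction from the erased labeling at \<open>n = 1\<close>. The first step gives the
  minimum the label \<open>2\<close>, which no later step touches; the branches follow
  \<open>slide_Suc\<close>.\<close>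

lemma partial_promotion:
  assumes "2 \<le> m" "1 \<le> n"
  defines "F \<equiv> \<lambda>n. fold (K_step r) [2..<Suc n] (K_erase P L)"
  shows "F n z = (if n = 1 then None else Some 2)
    \<and> (\<forall>i<k. \<forall>x\<in>B i. F n x = slide (L ` B i) n (L x))"
  using assms(2)
proof (induction n rule: dec_induct)
  case base
  have "L x \<noteq> 1" "1 < L x" if "i < k" "x \<in> B i" for i x
    using label_branch that by fastforce+
  then show ?case
    using label_z B_subset by (auto simp: F_def K_erase_def slide_def)
next
  case (step n)
  have F_Suc: "F (Suc n) = K_step r (Suc n) (F n)"
    using step(1) by (simp add: F_def)
  have IH: "F n z = (if n = 1 then None else Some 2)"
    "\<And>i x. i < k \<Longrightarrow> x \<in> B i \<Longrightarrow> F n x = slide (L ` B i) n (L x)"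
    using step.IH by auto
  have "F (Suc n) z = Some 2"
  proof (cases "n = 1")
    case True
    \<comment> \<open>Since \<open>2 \<le> m\<close>, some element has label \<open>2\<close>; being
      lowest in its branch, it covers the minimum.\<close>
    have "2 \<in> (\<Union>i<k. L ` B i)"
      using L labelings_iff assms(1) by auto
    then obtain i x where x: "i < k" "x \<in> B i" "L x = 2"
      by force
    have "\<not> (\<exists>c\<in>L ` B i. c < L x)"
      using x label_branch by fastforce
    then have "covered_by r z x"
      using covered_by_least_iff x by blast
    moreover have "F n x = Some 2"
      using IH(2)[OF x(1,2)] x True by (simp add: slide_def)
    ultimately have "\<exists>y. covered_by r z y \<and> F n y = Some (Suc n)"
      using True by auto
    then show ?thesis
      unfolding F_Suc K_step_def using IH(1) True by simp
  next
    case False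
    then show ?thesis
      using IH(1) step(1) by (simp add: F_Suc K_step_def)
  qed
  moreover have "F (Suc n) x = slide (L ` B i) (Suc n) (L x)" if x: "i < k" "x \<in> B i" for i x
  proof -
    have A: "finite (L ` B i)" "L ` B i \<subseteq> {2..}" "L x \<in> L ` B i"
      using finite_B label_branch x by fastforce+
    have up: "(\<exists>y. covered_by r x y \<and> F n y = Some (Suc n)) \<longleftrightarrow>
        (\<exists>b\<in>L ` B i. next_in (L ` B i) (L x) b \<and> slide (L ` B i) n b = Some (Suc n))"
      unfolding covers_of_branch[OF x] using IH(2)[OF x(1)] by auto
    have down: "(\<exists>w. covered_by r w x \<and> F n w = None) \<longleftrightarrow>
        n = 1 \<and> \<not> (\<exists>c\<in>L ` B i. c < L x) \<or>
        (\<exists>b\<in>L ` B i. next_in (L ` B i) b (L x) \<and> slide (L ` B i) n b = None)"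
      unfolding covered_of_branch[OF x] using IH(2)[OF x(1)] IH(1) by auto
    show ?thesis
      unfolding F_Suc K_step_def up down IH(2)[OF x] slide_Suc[OF A step(1)] by simp
  qed
  ultimately show ?case
    using step(1) by simp
qed

lemma prom_branch:
  assumes "i < k" "x \<in> B i"
  shows "prom L x = promote_label m (L ` B i) (L x)"
proof -
  have "2 \<le> m"
    using label_branch assms by fastforce
  with partial_promotion[of m] m_pos assms B_subset[OF assms] show ?thesis
    by (simp add: K_promotion_def promote_label_def)
qed

lemma prom_z: "prom L z = 1"
proof (cases "m = 1")
  \<comment> \<open>No step takes place: the minimum ends unlabeled and receives \<open>m\<close>,
    which is \<open>1\<close>.\<close>
  case True
  then show ?thesis
    using z_in label_z by (simp add: K_promotion_def K_erase_def)
next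
  case False
  then show ?thesis
    using partial_promotion[of m] m_pos z_in by (simp add: K_promotion_def)
qed

lemma prom_image:
  assumes "i < k"
  shows "prom L ` B i = cyc m ` (L ` B i)"
proof -
  have "prom L ` B i = promote_label m (L ` B i) ` (L ` B i)"
    using prom_branch[OF assms] by (simp add: image_image)
  then show ?thesis
    using promote_label_image[OF label_branch[OF assms]] by simp
qed

lemma prom_mem: "prom L \<in> labs"
proof -
  have "prom L x < prom L y" if "i < k" "x \<in> B i" "y \<in> B i" "(x, y) \<in> r" "x \<noteq> y" for i x y
    using that promote_label_less[OF label_branch[OF that(1)]] label_less_iff[OF that(1-3)]
    by (simp add: prom_branch)
  moreover have "(\<Union>i<k. prom L ` B i) = cyc m ` (\<Union>i<k. L ` B i)"
    using prom_image by auto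
  moreover have "(\<Union>i<k. L ` B i) = {2..m}"
    using L labelings_iff by blast
  ultimately show ?thesis
    unfolding labelings_iff using prom_z cyc_image by (auto simp: K_promotion_def)
qed

end

section \<open>Labelings and their branch label sets\<close>

lemma labeling_eqI:
  assumes L: "L \<in> labs" "L' \<in> labs" and eq: "\<And>i. i < k \<Longrightarrow> L ` B i = L' ` B i"
  shows "L = L'"
proof (rule extensionalityI)
  show "L \<in> extensional P" "L' \<in> extensional P"
    using L labelings_iff by blast+
  fix x assume "x \<in> P"
  then show "L x = L' x"
  proof (cases rule: P_cases)
    case 1
    then show ?thesis using L[THEN label_z] by simp
  next
    case (2 i)
    \<comment> \<open>On a branch both labelings represent the same chain order with the same
      image.\<close>
    show ?thesis
    proof (rule strict_mono_unique_image[where C = "B i" and R = "\<lambda>x y. (x, y) \<in> r \<and> x \<noteq> y"])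
    qed (use 2 finite_B label_less_iff label_inj_on eq L in auto)
  qed
qed

text \<open>\<open>L\<close> serves as a template: its labels on each branch are replaced through an
  increasing bijection onto the prescribed set of the same size.\<close>

lemma labeling_exists:
  assumes L: "L \<in> labs"
    and A: "\<And>i. i < k \<Longrightarrow> A i \<subseteq> {2..m} \<and> card (A i) = card (L ` B i)"
    and un: "(\<Union>i<k. A i) = {2..m}"
  obtains L' where "L' \<in> labs" "\<And>i. i < k \<Longrightarrow> L' ` B i = A i"
proof -
  have "\<exists>h. bij_betw h (L ` B i) (A i) \<and>
      (\<forall>a\<in>L ` B i. \<forall>b\<in>L ` B i. a < b \<longrightarrow> h a < h b)" if i: "i < k" for i
  proof -
    have "finite (A i)" using A[OF i] finite_subset by blast
    then show ?thesis
      using strict_mono_bij_betw_exists[of "L ` B i" "A i"] A[OF i] finite_B[OF i]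
      by (metis finite_imageI)
  qed
  then obtain h where h: "\<And>i. i < k \<Longrightarrow> bij_betw (h i) (L ` B i) (A i)"
    "\<And>i a b. i < k \<Longrightarrow> a \<in> L ` B i \<Longrightarrow> b \<in> L ` B i \<Longrightarrow> a < b \<Longrightarrow> h i a < h i b"
    by metis
  \<comment> \<open>The description picks the branch of \<open>x\<close>, which is unique by
    disjointness.\<close>
  define L' where "L' = (\<lambda>x\<in>P. if x = z then 1 else h (THE i. i < k \<and> x \<in> B i) (L x))"
  have br: "L' x = h i (L x)" if "i < k" "x \<in> B i" for i x
  proof -
    have "(THE i. i < k \<and> x \<in> B i) = i"
      using that B_disjoint by blast
    then show ?thesis
      using that z_notin B_subset by (auto simp: L'_def)
  qed
  have img: "L' ` B i = A i" if i: "i < k" for i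
  proof -
    have "L' ` B i = h i ` (L ` B i)"
      using br[OF i] by (simp add: image_image)
    then show ?thesis
      using h(1)[OF i] by (simp add: bij_betw_def)
  qed
  have "L' \<in> labs"
    unfolding labelings_iff
  proof (intro conjI allI impI ballI)
    show "L' \<in> extensional P" "L' z = 1"
      using z_in by (auto simp: L'_def)
    show "(\<Union>i<k. L' ` B i) = {2..m}"
      using img un by simp
    show "L' x < L' y" if "i < k" "x \<in> B i" "y \<in> B i" "(x, y) \<in> r \<and> x \<noteq> y" for i x y
      using that br h(2) label_less_iff[OF L that(1-3)] by simp
  qed
  with img show ?thesis using that by blast
qed

section \<open>Iterates of promotion\<close>

lemma funpow_prom_mem: "L \<in> labs \<Longrightarrow> (prom ^^ n) L \<in> labs"
  by (induction n) (auto intro: prom_mem)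

lemma funpow_prom_image:
  "L \<in> labs \<Longrightarrow> i < k \<Longrightarrow> (prom ^^ n) L ` B i = (cyc m ^^ n) ` (L ` B i)"
  by (induction n) (auto simp: prom_image funpow_prom_mem image_comp)

lemma funpow_prom_fixed:
  assumes "L \<in> labs" "m - 1 dvd n"
  shows "(prom ^^ n) L = L"
proof (rule labeling_eqI)
  fix i assume i: "i < k"
  have "(cyc m ^^ n) a = a" if "a \<in> L ` B i" for a
    using funpow_cyc_eq_iff label_branch[OF assms(1) i] assms(2) that by blast
  then show "(prom ^^ n) L ` B i = L ` B i"
    using funpow_prom_image[OF assms(1) i] by simp
qed (use assms funpow_prom_mem in auto)

text \<open>A branch of \<open>m - 1\<close> elements uses every label in \<open>{2..m}\<close>, a
  set that the shift preserves.\<close>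

lemma prom_fixed:
  assumes "L \<in> labs" "\<And>i. i < k \<Longrightarrow> card (B i) = m - 1"
  shows "prom L = L"
proof (rule labeling_eqI)
  fix i assume i: "i < k"
  have "card (L ` B i) = card {2..m}"
    using assms(2)[OF i] label_inj_on[OF assms(1) i] m_pos by (simp add: card_image)
  then have "L ` B i = {2..m}"
    using label_branch[OF assms(1) i] by (intro card_subset_eq) auto
  then show "prom L ` B i = L ` B i"
    using prom_image[OF assms(1) i] cyc_image by simp
qed (use assms prom_mem in auto)

text \<open>
  If \<open>b = \<sigma>\<^sup>n a \<noteq> a\<close> for the cyclic shift \<open>\<sigma>\<close> and some \<open>a\<close> in the label set of a branch that
  misses the label \<open>c\<close>, then exchanging \<open>b\<close> and \<open>c\<close> in all branches gives a labeling in which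
  this branch has \<open>a\<close> but not \<open>\<sigma>\<^sup>n a\<close>, so that \<open>n\<close> promotions move it.
\<close>

lemma moved_labeling_exists:
  assumes L: "L \<in> labs" and j: "j < k" "card (B j) \<noteq> m - 1" and n: "\<not> m - 1 dvd n"
  obtains L' where "L' \<in> labs" "(prom ^^ n) L' \<noteq> L'"
proof -
  obtain a where a: "a \<in> L ` B j"
    using B_nonempty[OF j(1)] by blast
  have sub: "L ` B j \<subseteq> {2..m}"
    using label_branch L j by blast
  have "L ` B j \<noteq> {2..m}"
    using j(2) label_inj_on[OF L j(1)] m_pos by (metis card_atLeastAtMost card_image diff_Suc_Suc numeral_2_eq_2 One_nat_def)
  then obtain c where c: "c \<in> {2..m}" "c \<notin> L ` B j"
    using sub by blast
  define b where "b = (cyc m ^^ n) a"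
  have b: "b \<in> {2..m}" "b \<noteq> a"
    using funpow_cyc_mem funpow_cyc_eq_iff a sub n by (auto simp: b_def)
  \<comment> \<open>If \<open>b = c\<close>, the transposition is the identity, and the branch
    already misses \<open>b\<close>.\<close>
  let ?t = "Transposition.transpose b c"
  have t: "?t ` {2..m} = {2..m}"
    using b c by (simp add: transpose_image_eq)
  have un: "(\<Union>i<k. L ` B i) = {2..m}"
    using L labelings_iff by blast
  obtain L' where L': "L' \<in> labs" "\<And>i. i < k \<Longrightarrow> L' ` B i = ?t ` (L ` B i)"
  proof (rule labeling_exists[OF L, of "\<lambda>i. ?t ` (L ` B i)"])
    show "?t ` (L ` B i) \<subseteq> {2..m} \<and> card (?t ` (L ` B i)) = card (L ` B i)" if "i < k" for i
    proof
      show "?t ` (L ` B i) \<subseteq> {2..m}"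
        using image_mono[OF label_branch[OF L that], of ?t] t by simp
      show "card (?t ` (L ` B i)) = card (L ` B i)"
        by (rule card_image) (meson inj_on_subset inj_transpose subset_UNIV)
    qed
    show "(\<Union>i<k. ?t ` (L ` B i)) = {2..m}"
      using un t by (metis image_UN)
  qed (use that in blast)
  \<comment> \<open>The exchange fixes \<open>a\<close>, which differs from \<open>b\<close> by the
    choice of \<open>n\<close> and from \<open>c\<close> because \<open>c\<close> is missing from
    the branch.\<close>
  have "a \<in> L' ` B j"
    using L'(2)[OF j(1)] a b c by (metis image_eqI transpose_apply_other)
  then have "b \<in> (prom ^^ n) L' ` B j"
    using funpow_prom_image[OF L'(1) j(1)] by (auto simp: b_def)
  moreover have "b \<notin> L' ` B j"
    using L'(2)[OF j(1)] c(2) by (metis imageE transpose_apply_second transpose_involutory)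
  ultimately show ?thesis
    using that L'(1) by metis
qed

section \<open>The order in the symmetric group\<close>

lemma perm_mem: "K_promotion_perm P r m \<in> carrier (BijGroup labs)"
proof -
  have inv: "(prom ^^ (m - 1)) L = L" if "L \<in> labs" for L
    using funpow_prom_fixed that by simp
  have "bij_betw prom labs labs"
  proof (cases "m - 1")
    \<comment> \<open>Here \<open>m = 1\<close>, so a nonempty branch would have no labels
      available; there are no branches, and \<open>prom_fixed\<close> applies vacuously.\<close>
    case 0
    then have "prom L = L" if "L \<in> labs" for L
      using funpow_prom_fixed[OF that, of 1] label_branch[OF that] B_nonempty prom_fixed[OF that]
      by fastforce
    then show ?thesis
      by (metis bij_betw_cong bij_betw_id id_apply)
  next
    case (Suc q)
    \<comment> \<open>As \<open>prom ^^ Suc q\<close> fixes every labeling, \<open>prom ^^ q\<close>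
      is a two-sided inverse.\<close>
    then have "prom ((prom ^^ q) L) = L" "(prom ^^ q) (prom L) = L" if "L \<in> labs" for L
      using inv[OF that] by (simp_all flip: funpow_swap1)
    then show ?thesis
      by (intro bij_betw_byWitness[where f' = "prom ^^ q"]) (auto intro: prom_mem funpow_prom_mem)
  qed
  then show ?thesis
    by (auto simp: BijGroup_def Bij_def K_promotion_perm_def cong: bij_betw_cong)
qed

lemma perm_pow:
  "K_promotion_perm P r m [^]\<^bsub>BijGroup labs\<^esub> (n::nat) = restrict (prom ^^ n) labs"
proof (induction n)
  case 0
  then show ?case by (auto simp: BijGroup_def)
next
  case (Suc n)
  interpret group "BijGroup labs" by (rule group_BijGroup)
  have "K_promotion_perm P r m [^]\<^bsub>BijGroup labs\<^esub> Suc n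
      = restrict (prom ^^ n) labs \<otimes>\<^bsub>BijGroup labs\<^esub> K_promotion_perm P r m"
    by (simp only: nat_pow_Suc Suc)
  also have "\<dots> = compose labs (restrict (prom ^^ n) labs) (K_promotion_perm P r m)"
    using perm_mem nat_pow_closed[OF perm_mem, of n] unfolding Suc by (simp add: BijGroup_def)
  also have "\<dots> = restrict (prom ^^ Suc n) labs"
    using prom_mem by (auto simp: compose_def K_promotion_perm_def funpow_swap1)
  finally show ?case .
qed

text \<open>Both bounds on the order come from this: fixed labelings for a given \<open>n\<close>
  bound it above, and taking \<open>n\<close> to be the order itself bounds it below.\<close>

lemma ord_dvd_iff:
  "group.ord (BijGroup labs) (K_promotion_perm P r m) dvd n \<longleftrightarrow> (\<forall>L\<in>labs. (prom ^^ n) L = L)"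
proof -
  interpret group "BijGroup labs" by (rule group_BijGroup)
  have "ord (K_promotion_perm P r m) dvd n \<longleftrightarrow> restrict (prom ^^ n) labs = (\<lambda>L\<in>labs. L)"
    using pow_eq_id[OF perm_mem, of n] perm_pow[of n] by (simp add: BijGroup_def)
  also have "\<dots> \<longleftrightarrow> (\<forall>L\<in>labs. (prom ^^ n) L = L)"
    by (auto simp: fun_eq_iff)
  finally show ?thesis .
qed

end

theorem theorem3p1:
  fixes P :: "'a set" and r :: "'a rel" and bs :: "nat list" and m :: nat
  assumes "extended_star P r bs"
    and "m \<ge> 1"
    and "packed_labelings P r m \<noteq> {}"
  shows "K_promotion_perm P r m \<in> carrier (BijGroup (packed_labelings P r m)) \<and>
    group.ord (BijGroup (packed_labelings P r m)) (K_promotion_perm P r m) =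
      (if \<forall>i<length bs. bs ! i = m - 1 then 1 else m - 1)"
proof -
  obtain z B where zB: "\<forall>x\<in>P. (z, x) \<in> r" "P = insert z (\<Union>i<length bs. B i)"
    "\<forall>i<length bs. z \<notin> B i \<and> finite (B i) \<and> card (B i) = bs ! i \<and> 1 \<le> bs ! i \<and> total_on (B i) r"
    "\<forall>i<length bs. \<forall>j<length bs. i \<noteq> j \<longrightarrow>
      (\<forall>x\<in>B i. \<forall>y\<in>B j. (x, y) \<notin> r \<and> (y, x) \<notin> r)"
    and po: "partial_order_on P r"
    using assms(1) unfolding extended_star_def by metis
  interpret star P r z B "length bs" m
  proof
    show "B i \<noteq> {}" if "i < length bs" for i
      using zB(3) that by fastforce
  qed (use zB po assms(2) in blast)+
  obtain L where L: "L \<in> labs"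
    using assms(3) by blast
  let ?o = "group.ord (BijGroup labs) (K_promotion_perm P r m)"
  have "?o = (if \<forall>i<length bs. bs ! i = m - 1 then 1 else m - 1)"
  proof (cases "\<forall>i<length bs. bs ! i = m - 1")
    case True
    then have "?o dvd 1"
      unfolding ord_dvd_iff using prom_fixed zB(3) by simp
    with True show ?thesis by simp
  next
    case False
    then obtain j where j: "j < length bs" "card (B j) \<noteq> m - 1"
      using zB(3) by auto
    have "?o dvd m - 1"
      unfolding ord_dvd_iff using funpow_prom_fixed by simp
    \<comment> \<open>The power by the order fixes every labeling, which is impossible for an
      exponent not divisible by \<open>m - 1\<close>.\<close>
    moreover have "m - 1 dvd ?o"
      using moved_labeling_exists[OF L j, of ?o] ord_dvd_iff[of ?o] by (metis dvd_refl)
    ultimately show ?thesis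
      using False dvd_antisym by auto
  qed
  with perm_mem show ?thesis by blast
qed

end
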